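(* Let $p$ be a prime, $q$ a power of $p$, $m$ a positive integer, and $a,b\in\mathbb{F}_q$ with $b\neq a^m$. Then the Galois group of the polynomial $F=x^m-b-t(x-a)\in\mathbb{F}_q(t)[x]$ over $\mathbb{F}_q(t)$, acting on the roots of $F$, is primitive.
   Context: Here $t$ is transcendental over $\mathbb{F}_q$. *)

theory Defs
  imports
    "HOL-Algebra.Algebraic_Closure_Type"
    "HOL-Algebra.Generated_Fields"
    "HOL-Algebra.Group_Action"
    "HOL-Computational_Algebra.Computational_Algebra"
begin

text \<open>Roots of a polynomial over \<open>'k\<close> are taken in the algebraic closure of \<open>'k\<close>, into which
  \<open>'k\<close> embeds by \<^const>\<open>to_ac\<close>.\<close>

definition roots_ac :: "'k::field poly \<Rightarrow> 'k alg_closure set" where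
  "roots_ac f = {x. poly (map_poly to_ac f) x = 0}"

definition splitting_field :: "'k::field poly \<Rightarrow> 'k alg_closure set" where
  "splitting_field f = generate_field ring_of_type_algebra (range to_ac \<union> roots_ac f)"

definition splitting_ring :: "'k::field poly \<Rightarrow> 'k alg_closure ring" where
  "splitting_ring f = ring_of_type_algebra\<lparr>carrier := splitting_field f\<rparr>"

text \<open>The field automorphisms of the splitting field that fix the base field pointwise, under
  composition. As in \<^const>\<open>BijGroup\<close>, they are made extensional (\<^const>\<open>undefined\<close> outside of
  the splitting field), so that each automorphism is represented by exactly one function.\<close>

definition galois_group :: "'k::field poly \<Rightarrow> ('k alg_closure \<Rightarrow> 'k alg_closure) monoid" where
  "galois_group f = (BijGroup (splitting_field f))
     \<lparr>carrier := {\<sigma> \<in> ring_iso (splitting_ring f) (splitting_ring f).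
                   \<sigma> \<in> extensional (splitting_field f) \<and> (\<forall>c. \<sigma> (to_ac c) = to_ac c)}\<rparr>"

definition galois_action ::
    "'k::field poly \<Rightarrow> ('k alg_closure \<Rightarrow> 'k alg_closure) \<Rightarrow> 'k alg_closure \<Rightarrow> 'k alg_closure" where
  "galois_action f \<sigma> = restrict \<sigma> (roots_ac f)"

definition is_block :: "('g, 'c) monoid_scheme \<Rightarrow> 'e set \<Rightarrow> ('g \<Rightarrow> 'e \<Rightarrow> 'e) \<Rightarrow> 'e set \<Rightarrow> bool" where
  "is_block G E \<phi> B \<longleftrightarrow> B \<subseteq> E \<and> B \<noteq> {} \<and>
     (\<forall>g\<in>carrier G. \<phi> g ` B = B \<or> \<phi> g ` B \<inter> B = {})"

text \<open>A primitive action is a transitive action on a nonempty set all of whose blocks are trivial.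
  The action on a one-point set counts as primitive.\<close>

locale primitive_action = transitive_action +
  assumes nonempty: "E \<noteq> {}"
    and trivial_blocks: "is_block G E \<phi> B \<Longrightarrow> (\<exists>x. B = {x}) \<or> B = E"

text \<open>The rational function field in \<open>t\<close> over \<open>'a\<close> is the type \<open>'a poly fract\<close>; this is its
  element \<open>t\<close> and the embedding of the constants.\<close>

definition rf_var :: "'a::field poly fract" where
  "rf_var = to_fract [:0, 1:]"

definition rf_const :: "'a::field \<Rightarrow> 'a poly fract" where
  "rf_const c = to_fract [:c:]"

definition F_poly :: "nat \<Rightarrow> 'a::field \<Rightarrow> 'a \<Rightarrow> 'a poly fract poly" where
  "F_poly m a b = [:0, 1:] ^ m - [:rf_const b:] - smult rf_var ([:0, 1:] - [:rf_const a:])"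

end

theory Submission
  imports Defs
begin

text \<open>
  The Galois group acts even doubly transitively on the roots. A root \<open>x\<close> satisfies
  \<open>t = (x ^ m - b) / (x - a)\<close>, hence it is transcendental over the constants and \<open>K(x)\<close> is a
  rational function field in which \<open>t\<close> is always the same expression in \<open>x\<close>; this gives
  transitivity. Over \<open>K(x)\<close>, the other roots are the roots of
  \<open>(x - a) * (\<Sum>i<m. x ^ (m - 1 - i) * X ^ i) - (x ^ m - b)\<close>,
  whose reciprocal polynomial is Eisenstein at the prime \<open>x - a\<close>, because \<open>b \<noteq> a ^ m\<close>. So the
  stabilizer of \<open>x\<close> is transitive on the other roots.
\<close>

text \<open>All intermediate fields are subsets of one algebraic closure, so homomorphisms live on
  carrier sets. Every automorphism arises in the same way. Two evaluations of one polynomial ring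
  with equal kernels induce a map between their images. It passes to fractions, and it fixes F_q(t)
  because t is a quotient of the values of two fixed ring elements. It is then extended to the
  splitting field. For transitivity the ring is F_q[x] and both kernels are zero. For the stabilizer
  it is F_q[x][X], and both kernels consist of the multiples of one irreducible polynomial up to
  nonzero scalars from F_q[x]. These scalars stand in for denominators and let Eisenstein's argument
  run over F_q[x] itself.\<close>

hide_const (open) Polynomials.degree Polynomials.lead_coeff

subsection \<open>Ring homomorphisms on subrings\<close>

locale hom_on =
  fixes A :: "'r::comm_ring_1 set" and h :: "'r \<Rightarrow> 's::comm_ring_1"
  assumes one_mem: "1 \<in> A"
    and uminus_mem: "x \<in> A \<Longrightarrow> - x \<in> A"
    and add_mem: "x \<in> A \<Longrightarrow> y \<in> A \<Longrightarrow> x + y \<in> A"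
    and mult_mem: "x \<in> A \<Longrightarrow> y \<in> A \<Longrightarrow> x * y \<in> A"
    and hom_one: "h 1 = 1"
    and hom_add: "x \<in> A \<Longrightarrow> y \<in> A \<Longrightarrow> h (x + y) = h x + h y"
    and hom_mult: "x \<in> A \<Longrightarrow> y \<in> A \<Longrightarrow> h (x * y) = h x * h y"
begin

lemma zero_mem: "0 \<in> A"
  using add_mem[OF one_mem uminus_mem[OF one_mem]] by simp

lemma diff_mem: "x \<in> A \<Longrightarrow> y \<in> A \<Longrightarrow> x - y \<in> A"
  using add_mem[of x "- y"] uminus_mem by simp

lemma power_mem: "x \<in> A \<Longrightarrow> x ^ n \<in> A"
  by (induction n) (auto intro: one_mem mult_mem)

lemma sum_mem: "(\<And>i. i \<in> I \<Longrightarrow> f i \<in> A) \<Longrightarrow> sum f I \<in> A"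
  by (induction I rule: infinite_finite_induct) (auto intro: zero_mem add_mem)

lemma hom_zero: "h 0 = 0"
  using hom_add[OF zero_mem zero_mem] by simp

lemma hom_uminus: "x \<in> A \<Longrightarrow> h (- x) = - h x"
  using hom_add[of x "- x"] uminus_mem[of x] hom_zero by (simp add: eq_neg_iff_add_eq_0 add.commute)

lemma hom_diff: "x \<in> A \<Longrightarrow> y \<in> A \<Longrightarrow> h (x - y) = h x - h y"
  using hom_add[of x "- y"] uminus_mem hom_uminus by simp

lemma hom_power: "x \<in> A \<Longrightarrow> h (x ^ n) = h x ^ n"
  by (induction n) (auto simp: hom_one hom_mult power_mem)

lemma hom_sum: "(\<And>i. i \<in> I \<Longrightarrow> f i \<in> A) \<Longrightarrow> h (sum f I) = (\<Sum>i\<in>I. h (f i))"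
  by (induction I rule: infinite_finite_induct) (auto simp: hom_zero hom_add sum_mem)

lemma map_poly_add:
  assumes "\<And>i. coeff p i \<in> A" "\<And>i. coeff q i \<in> A"
  shows "map_poly h (p + q) = map_poly h p + map_poly h q"
  by (rule poly_eqI) (simp add: coeff_map_poly hom_zero hom_add assms)

lemma map_poly_mult:
  assumes "\<And>i. coeff p i \<in> A" "\<And>i. coeff q i \<in> A"
  shows "map_poly h (p * q) = map_poly h p * map_poly h q"
  by (rule poly_eqI)
     (simp add: coeff_map_poly hom_zero coeff_mult hom_sum hom_mult mult_mem assms)

lemma poly_mem: "(\<And>i. coeff p i \<in> A) \<Longrightarrow> x \<in> A \<Longrightarrow> poly p x \<in> A"
  by (auto simp: poly_altdef intro!: sum_mem mult_mem power_mem)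

lemma hom_poly:
  assumes "\<And>i. coeff p i \<in> A" "x \<in> A"
  shows "h (poly p x) = poly (map_poly h p) (h x)"
  using assms(1)
proof (induction p)
  case (pCons c p)
  have mem: "coeff p i \<in> A" "c \<in> A" for i
    using pCons.prems[of "Suc i"] pCons.prems[of 0] by auto
  then show ?case
    using pCons assms(2)
    by (simp add: map_poly_pCons hom_zero hom_add hom_mult mult_mem poly_mem)
qed (simp add: hom_zero)

text \<open>Coefficients are pushed through \<open>h\<close> before evaluation at \<open>s\<close>.
  The identity as \<open>h\<close> gives plain evaluation, and iterating the construction gives
  evaluation in two variables.\<close>

lemma hom_on_eval: "hom_on {p. \<forall>i. coeff p i \<in> A} (\<lambda>p. poly (map_poly h p) s)"
proof
  show "1 \<in> {p. \<forall>i. coeff p i \<in> A}"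
    by (auto simp: coeff_1 one_mem zero_mem)
  show "poly (map_poly h 1) s = 1"
    by (simp add: hom_one)
qed (auto simp: coeff_mult map_poly_add map_poly_mult intro!: uminus_mem add_mem mult_mem sum_mem)

end

text \<open>Homomorphism theorem: two preimages of one element differ by an element of the kernel of
  \<open>h\<close>, which \<open>h'\<close> also kills, so an arbitrary choice of preimage defines
  \<open>\<phi>\<close>.\<close>

lemma hom_on_factor:
  fixes h :: "'r::comm_ring_1 \<Rightarrow> 's::comm_ring_1" and h' :: "'r \<Rightarrow> 'u::comm_ring_1"
  assumes "hom_on A h" and "hom_on A h'"
    and ker: "\<And>x. x \<in> A \<Longrightarrow> h x = 0 \<Longrightarrow> h' x = 0"
  obtains \<phi> where "hom_on (h ` A) \<phi>" and "\<And>x. x \<in> A \<Longrightarrow> \<phi> (h x) = h' x"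
proof -
  interpret h: hom_on A h by fact
  interpret h': hom_on A h' by fact
  define \<phi> where "\<phi> z = h' (SOME x. x \<in> A \<and> h x = z)" for z
  have \<phi>: "\<phi> (h x) = h' x" if "x \<in> A" for x
  proof -
    have "(SOME y. y \<in> A \<and> h y = h x) \<in> A \<and> h (SOME y. y \<in> A \<and> h y = h x) = h x" (is "?y \<in> A \<and> _")
      by (rule someI[of _ x]) (use that in auto)
    then have "h' (?y - x) = 0"
      using ker[of "?y - x"] that by (simp add: h.diff_mem h.hom_diff)
    then show ?thesis
      using \<open>?y \<in> A \<and> _\<close> that by (simp add: h'.hom_diff \<phi>_def)
  qed
  have "hom_on (h ` A) \<phi>"
  proof
    show "1 \<in> h ` A"
      using h.hom_one h.one_mem by (metis imageI)
    show "\<phi> 1 = 1"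
      using \<phi>[OF h.one_mem] by (simp add: h.hom_one h'.hom_one)
  next
    fix x assume "x \<in> h ` A"
    then show "- x \<in> h ` A"
      by (auto simp flip: h.hom_uminus intro!: imageI h.uminus_mem)
  next
    fix x y assume "x \<in> h ` A" "y \<in> h ` A"
    then show "x + y \<in> h ` A" "x * y \<in> h ` A" "\<phi> (x + y) = \<phi> x + \<phi> y" "\<phi> (x * y) = \<phi> x * \<phi> y"
      by (auto simp flip: h.hom_add h.hom_mult
          simp: h.add_mem h.mult_mem \<phi> h'.hom_add h'.hom_mult intro!: imageI)
  qed
  with \<phi> that show ?thesis by blast
qed

text \<open>Extension to the field of fractions inside the ambient field. Injectivity keeps
  denominators nonzero after \<open>\<phi>\<close>, and cross-multiplication shows independence of
  the chosen fraction.\<close>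

lemma hom_on_fractions:
  fixes \<phi> :: "'s::field \<Rightarrow> 'u::field"
  assumes "hom_on L \<phi>" and inj: "\<And>x. x \<in> L \<Longrightarrow> \<phi> x = 0 \<Longrightarrow> x = 0"
  obtains L' \<phi>' where "hom_on L' \<phi>'" "L \<subseteq> L'" "\<And>x. x \<in> L \<Longrightarrow> \<phi>' x = \<phi> x"
    "\<And>x. x \<in> L' \<Longrightarrow> inverse x \<in> L'"
proof -
  interpret hom_on L \<phi> by fact
  define L' where "L' = {x / y | x y. x \<in> L \<and> y \<in> L \<and> y \<noteq> 0}"
  define \<phi>' where "\<phi>' z = (SOME w. \<exists>x\<in>L. \<exists>y\<in>L. y \<noteq> 0 \<and> z = x / y \<and> w = \<phi> x / \<phi> y)" for z
  have \<phi>': "\<phi>' (x / y) = \<phi> x / \<phi> y" if "x \<in> L" "y \<in> L" "y \<noteq> 0" for x y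
  proof -
    have "\<exists>u\<in>L. \<exists>v\<in>L. v \<noteq> 0 \<and> x / y = u / v \<and> \<phi>' (x / y) = \<phi> u / \<phi> v"
      unfolding \<phi>'_def by (rule someI[of _ "\<phi> x / \<phi> y"]) (use that in auto)
    then obtain u v where uv: "u \<in> L" "v \<in> L" "v \<noteq> 0" "x / y = u / v" "\<phi>' (x / y) = \<phi> u / \<phi> v"
      by blast
    then have "\<phi> (x * v) = \<phi> (u * y)"
      using that by (simp add: frac_eq_eq)
    moreover have "\<phi> v \<noteq> 0" "\<phi> y \<noteq> 0"
      using inj uv that by auto
    ultimately show ?thesis
      using uv that by (simp add: hom_mult frac_eq_eq)
  qed
  have L'I: "x / y \<in> L'" if "x \<in> L" "y \<in> L" "y \<noteq> 0" for x y
    using that by (auto simp: L'_def)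
  have ext: "x \<in> L'" "\<phi>' x = \<phi> x" if "x \<in> L" for x
    using L'I[OF that one_mem] \<phi>'[OF that one_mem] by (auto simp: hom_one)
  have "hom_on L' \<phi>'"
  proof
    show "1 \<in> L'" "\<phi>' 1 = 1"
      using ext[OF one_mem] by (auto simp: hom_one)
  next
    fix z assume "z \<in> L'"
    then obtain x y where "x \<in> L" "y \<in> L" "y \<noteq> 0" "z = x / y"
      by (auto simp: L'_def)
    then show "- z \<in> L'"
      using L'I[OF uminus_mem] by simp
  next
    fix z w assume "z \<in> L'" "w \<in> L'"
    then obtain x y u v where xy: "x \<in> L" "y \<in> L" "y \<noteq> 0" "z = x / y"
      and uv: "u \<in> L" "v \<in> L" "v \<noteq> 0" "w = u / v"
      by (auto simp: L'_def)
    have nz: "\<phi> v \<noteq> 0" "\<phi> y \<noteq> 0"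
      using inj xy uv by auto
    have sum: "z + w = (x * v + u * y) / (y * v)" and prod: "z * w = (x * u) / (y * v)"
      using xy uv by (auto simp: field_simps)
    have mem: "x * v + u * y \<in> L" "y * v \<in> L" "x * u \<in> L" "y * v \<noteq> 0"
      using xy uv by (auto intro: add_mem mult_mem)
    show "z + w \<in> L'" "z * w \<in> L'"
      unfolding sum prod by (auto intro!: L'I mem)
    show "\<phi>' (z + w) = \<phi>' z + \<phi>' w"
    proof -
      have "\<phi>' (z + w) = (\<phi> x * \<phi> v + \<phi> u * \<phi> y) / (\<phi> y * \<phi> v)"
        unfolding sum \<phi>'[OF mem(1,2,4)] using xy(1,2) uv(1,2) by (simp add: hom_add hom_mult mult_mem)
      also have "\<dots> = \<phi>' z + \<phi>' w"
        using nz by (simp add: xy(4) uv(4) \<phi>'[OF xy(1-3)] \<phi>'[OF uv(1-3)] field_simps)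
      finally show ?thesis .
    qed
    show "\<phi>' (z * w) = \<phi>' z * \<phi>' w"
      unfolding prod using mem xy uv nz by (simp add: \<phi>' hom_mult)
  qed
  moreover have "inverse z \<in> L'" if z: "z \<in> L'" for z
  proof -
    obtain x y where xy: "x \<in> L" "y \<in> L" "y \<noteq> 0" "z = x / y"
      using z by (auto simp: L'_def)
    show ?thesis
      using xy L'I[of y x] ext(1)[OF zero_mem] by (cases "x = 0") auto
  qed
  ultimately show ?thesis
    using that ext by blast
qed

lemma hom_on_inj:
  fixes \<phi> :: "'s::field \<Rightarrow> 'u::field"
  assumes "hom_on L \<phi>" and "\<And>x. x \<in> L \<Longrightarrow> inverse x \<in> L"
  shows "inj_on \<phi> L"
proof (rule inj_onI)
  interpret hom_on L \<phi> by fact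
  fix x y assume xy: "x \<in> L" "y \<in> L" "\<phi> x = \<phi> y"
  have mem: "x - y \<in> L" "inverse (x - y) \<in> L"
    using xy assms(2) diff_mem by auto
  have "\<phi> (x - y) * \<phi> (inverse (x - y)) = 1" if "x \<noteq> y"
    unfolding hom_mult[OF mem, symmetric] using that by (simp add: hom_one)
  then show "x = y"
    using xy by (auto simp: hom_diff)
qed

lemma hom_on_to_ac: "hom_on UNIV to_ac"
  by standard auto

text \<open>A subring between a field and its algebraic closure is a field: an equation c + x * q(x)
  = 0 of least degree has c nonzero, and solving it for 1/x stays inside the subring.\<close>

lemma to_ac_inverse_closed:
  assumes "hom_on L \<phi>" and base: "range to_ac \<subseteq> L" and "x \<in> L"
  shows "inverse x \<in> L"
proof (cases "x = 0")
  case True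
  then show ?thesis using assms by simp
next
  case False
  interpret hom_on L \<phi> by fact
  define P where "P p \<longleftrightarrow> p \<noteq> 0 \<and> poly (map_poly to_ac p) x = 0" for p
  obtain p0 where "P p0"
    using alg_closure_algebraic[of x] P_def by blast
  then obtain p where p: "P p" and min: "\<And>q. P q \<Longrightarrow> degree p \<le> degree q"
    using arg_min_nat_lemma[of P p0 degree] by metis
  obtain c q where pq: "p = pCons c q"
    by (cases p)
  have ev: "to_ac c + x * poly (map_poly to_ac q) x = 0"
    using p by (simp add: P_def pq map_poly_pCons)
  \<comment> \<open>Otherwise the factor \<open>x\<close> cancels and \<open>q\<close> is a shorter
    equation.\<close>
  have "c \<noteq> 0"
  proof
    assume "c = 0"
    then have "P q"
      using p ev False by (auto simp: P_def pq)
    then show False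
      using min[of q] p by (auto simp: pq P_def split: if_splits)
  qed
  have "poly (map_poly to_ac q) x \<in> L" for q
    by (induction q)
       (use base \<open>x \<in> L\<close> in \<open>auto simp: map_poly_pCons intro!: add_mem mult_mem zero_mem\<close>)
  moreover have "inverse x = to_ac (- inverse c) * poly (map_poly to_ac q) x"
    using ev False \<open>c \<noteq> 0\<close> by (simp add: field_simps eq_neg_iff_add_eq_0)
  moreover have "to_ac (- inverse c) \<in> L"
    using base by blast
  ultimately show ?thesis
    using mult_mem by metis
qed

subsection \<open>Extension of homomorphisms in the algebraic closure\<close>

locale algebra_hom = hom_on L \<phi>
  for L :: "'k::field alg_closure set" and \<phi> :: "'k alg_closure \<Rightarrow> 'k alg_closure" +
  assumes to_ac_mem: "to_ac c \<in> L" and hom_to_ac: "\<phi> (to_ac c) = to_ac c"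
begin

lemma inverse_mem: "x \<in> L \<Longrightarrow> inverse x \<in> L"
  using to_ac_inverse_closed[OF hom_on_axioms] to_ac_mem by blast

lemma inj: "inj_on \<phi> L"
  using hom_on_inj[OF hom_on_axioms inverse_mem] .

lemma hom_eq_0_iff: "x \<in> L \<Longrightarrow> \<phi> x = 0 \<longleftrightarrow> x = 0"
  using inj_on_eq_iff[OF inj _ zero_mem] by (simp add: hom_zero)

lemma map_poly_to_ac: "map_poly \<phi> (map_poly to_ac f) = map_poly to_ac f"
  by (rule poly_eqI) (simp add: coeff_map_poly hom_zero hom_to_ac)

lemma root_hom:
  assumes "x \<in> L" "x \<in> roots_ac f"
  shows "\<phi> x \<in> roots_ac f"
  using hom_poly[of "map_poly to_ac f" x] assms
  by (simp add: roots_ac_def coeff_map_poly to_ac_mem map_poly_to_ac hom_zero)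

text \<open>The point is that the quotient keeps its coefficients in \<open>L\<close>; leading terms
  are cancelled with inverses taken inside \<open>L\<close>.\<close>

lemma poly_division:
  assumes f: "\<And>i. coeff f i \<in> L" and g: "\<And>i. coeff g i \<in> L" and "g \<noteq> 0"
  shows "\<exists>q. (\<forall>i. coeff q i \<in> L) \<and> (f - q * g = 0 \<or> degree (f - q * g) < degree g)"
  using f
proof (induction "degree f" arbitrary: f rule: less_induct)
  case less
  show ?case
  proof (cases "f = 0 \<or> degree f < degree g")
    case True
    then show ?thesis
      using zero_mem by (intro exI[of _ 0]) auto
  next
    case False
    define c where "c = lead_coeff f * inverse (lead_coeff g)"
    define m where "m = monom c (degree f - degree g)"
    have m: "coeff m i \<in> L" for i
      using less.prems g by (auto simp: m_def c_def zero_mem inverse_mem intro!: mult_mem)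
    have fm: "coeff (f - m * g) i \<in> L" for i
      unfolding coeff_diff coeff_mult by (intro diff_mem sum_mem mult_mem less.prems g m)
    have "degree (f - m * g) \<le> degree f"
      using False degree_mult_le[of m g] degree_monom_le[of c "degree f - degree g"]
      by (intro degree_diff_le) (auto simp: m_def)
    moreover have "coeff (f - m * g) (degree f) = 0"
      using False \<open>g \<noteq> 0\<close> by (simp add: m_def c_def coeff_monom_mult)
    ultimately consider "f - m * g = 0" | "degree (f - m * g) < degree f"
      using eq_zero_or_degree_less by blast
    then show ?thesis
    proof cases
      case 1
      then show ?thesis using m by blast
    next
      case 2
      then obtain q where q: "\<And>i. coeff q i \<in> L"
        "f - m * g - q * g = 0 \<or> degree (f - m * g - q * g) < degree g"
        using less.hyps[OF 2 fm] by blast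
      moreover have "f - m * g - q * g = f - (m + q) * g"
        by (simp add: algebra_simps)
      moreover have "coeff (m + q) i \<in> L" for i
        using m q(1) by (simp add: add_mem)
      ultimately show ?thesis by metis
    qed
  qed
qed

text \<open>Adjoins one element \<open>r\<close>: it is sent to a root \<open>s\<close> of the image
  under \<open>\<phi>\<close> of its minimal polynomial \<open>g\<close> over \<open>L\<close>. The
  two evaluations of L[X], at \<open>r\<close> and at \<open>s\<close>, are then compared by
  \<open>hom_on_factor\<close>.\<close>

lemma extend:
  obtains L' \<phi>' where "algebra_hom L' \<phi>'" "L \<subseteq> L'" "r \<in> L'" "\<And>x. x \<in> L \<Longrightarrow> \<phi>' x = \<phi> x"
proof -
  define LX where "LX = {p. \<forall>i. coeff p i \<in> L}"
  define P where "P p \<longleftrightarrow> p \<in> LX \<and> p \<noteq> 0 \<and> poly p r = 0" for p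
  obtain f where f: "f \<noteq> 0" "poly (map_poly to_ac f) r = 0"
    using alg_closure_algebraic[of r] by blast
  then have "P (map_poly to_ac f)"
    by (auto simp: P_def LX_def coeff_map_poly to_ac_mem map_poly_eq_0_iff)
  then obtain g where g: "P g" and min: "\<And>q. P q \<Longrightarrow> degree g \<le> degree q"
    using arg_min_nat_lemma[of P _ degree] by metis
  have "degree g > 0"
    using g by (auto simp: P_def intro!: Nat.gr0I elim!: degree_eq_zeroE)
  \<comment> \<open>Injectivity of \<open>\<phi>\<close> keeps the leading coefficient nonzero, so
    the image of \<open>g\<close> is not constant and has a root.\<close>
  moreover have "coeff (map_poly \<phi> g) (degree g) \<noteq> 0"
    using g by (simp add: coeff_map_poly hom_zero hom_eq_0_iff P_def LX_def)
  then have "degree (map_poly \<phi> g) \<ge> degree g"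
    by (rule le_degree)
  ultimately obtain s where s: "poly (map_poly \<phi> g) s = 0"
    using alg_closed_imp_poly_has_root[of "map_poly \<phi> g"] by auto
  define h h' where "h p = poly p r" and "h' p = poly (map_poly \<phi> p) s"
    for p :: "'k alg_closure poly"
  have h': "hom_on LX h'"
    unfolding LX_def h'_def by (rule hom_on_eval)
  have "hom_on L (\<lambda>x. x)"
    by standard (auto intro: one_mem uminus_mem add_mem mult_mem)
  moreover have "h = (\<lambda>p. poly (map_poly (\<lambda>x. x) p) r)"
    by (simp add: h_def fun_eq_iff)
  ultimately have h: "hom_on LX h"
    using hom_on.hom_on_eval[of L "\<lambda>x. x" r] by (simp add: LX_def)
  interpret h: hom_on LX h by fact
  interpret h': hom_on LX h' by fact
  \<comment> \<open>The remainder of \<open>p\<close> modulo \<open>g\<close> also vanishes at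
    \<open>r\<close>, so it is 0 by minimality; multiples of \<open>g\<close> are killed by
    \<open>h'\<close> because \<open>s\<close> is a root of the image of \<open>g\<close>.\<close>
  have "h' p = 0" if p: "p \<in> LX" "h p = 0" for p
  proof -
    have "\<exists>q. (\<forall>i. coeff q i \<in> L) \<and> (p - q * g = 0 \<or> degree (p - q * g) < degree g)"
      by (rule poly_division) (use p g in \<open>auto simp: LX_def P_def\<close>)
    then obtain q where q: "q \<in> LX" "p - q * g = 0 \<or> degree (p - q * g) < degree g"
      by (auto simp: LX_def)
    moreover have "P (p - q * g)" if "p \<noteq> q * g"
      using p q g that by (auto simp: P_def h_def intro!: h.diff_mem h.mult_mem)
    ultimately have "p = q * g"
      using min[of "p - q * g"] by (meson eq_iff_diff_eq_0 not_le)
    then show ?thesis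
      using h'.hom_mult[of q g] q g s by (simp add: P_def h'_def)
  qed
  then obtain \<phi>' where \<phi>': "hom_on (h ` LX) \<phi>'" "\<And>x. x \<in> LX \<Longrightarrow> \<phi>' (h x) = h' x"
    using hom_on_factor[OF h h'] by metis
  have "x \<in> h ` LX \<and> \<phi>' x = \<phi> x" if "x \<in> L" for x
  proof -
    have "[:x:] \<in> LX" "h [:x:] = x" "h' [:x:] = \<phi> x"
      using that zero_mem
      by (auto simp: LX_def h_def h'_def map_poly_pCons coeff_pCons hom_zero split: nat.splits)
    then show ?thesis
      using \<phi>'(2)[of "[:x:]"] by (metis imageI)
  qed
  moreover have "[:0, 1:] \<in> LX" "h [:0, 1:] = r"
    using zero_mem one_mem by (auto simp: LX_def h_def coeff_pCons split: nat.splits)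
  then have "r \<in> h ` LX" by (metis imageI)
  moreover have "algebra_hom (h ` LX) \<phi>'"
    using \<phi>'(1) calculation(1) to_ac_mem hom_to_ac
    by (auto simp: algebra_hom_def algebra_hom_axioms_def)
  ultimately show ?thesis
    using that by blast
qed

end

lemma (in algebra_hom) extend_finite:
  assumes "finite R"
  obtains L' \<phi>' where "algebra_hom L' \<phi>'" "L \<subseteq> L'" "R \<subseteq> L'" "\<And>x. x \<in> L \<Longrightarrow> \<phi>' x = \<phi> x"
  using assms
proof (induction R arbitrary: thesis)
  case empty
  then show ?case using algebra_hom_axioms by blast
next
  case (insert r R)
  obtain L' \<phi>' where L': "algebra_hom L' \<phi>'" "L \<subseteq> L'" "R \<subseteq> L'" "\<And>x. x \<in> L \<Longrightarrow> \<phi>' x = \<phi> x"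
    using insert.IH by blast
  obtain L'' \<phi>'' where "algebra_hom L'' \<phi>''" "L' \<subseteq> L''" "r \<in> L''" "\<And>x. x \<in> L' \<Longrightarrow> \<phi>'' x = \<phi>' x"
    using algebra_hom.extend[OF L'(1), of r] by blast
  with L' show ?case
    by (intro insert.prems[of L'' \<phi>'']) auto
qed

subsection \<open>Galois groups and their action on roots\<close>

lemma ring_of_type_algebra_simps [simp]:
  "carrier (ring_of_type_algebra :: 'a::comm_ring_1 ring) = UNIV"
  "\<one>\<^bsub>(ring_of_type_algebra :: 'a ring)\<^esub> = 1"
  "\<zero>\<^bsub>(ring_of_type_algebra :: 'a ring)\<^esub> = 0"
  "x \<oplus>\<^bsub>(ring_of_type_algebra :: 'a ring)\<^esub> y = x + y"
  "x \<otimes>\<^bsub>(ring_of_type_algebra :: 'a ring)\<^esub> y = x * y"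
  by (simp_all add: ring_of_type_algebra_def)

lemma a_inv_ring_of_type_algebra [simp]:
  "\<ominus>\<^bsub>ring_of_type_algebra\<^esub> (x :: 'a::comm_ring_1) = - x"
proof -
  interpret cring "ring_of_type_algebra :: 'a ring" ..
  show ?thesis by (rule minus_equality) auto
qed

lemma m_inv_ring_of_type_algebra [simp]:
  "x \<noteq> 0 \<Longrightarrow> inv\<^bsub>ring_of_type_algebra\<^esub> (x :: 'a::Fields.field) = inverse x"
proof -
  interpret cring "ring_of_type_algebra :: 'a ring" ..
  show "inv\<^bsub>ring_of_type_algebra\<^esub> x = inverse x" if "x \<noteq> 0"
    by (rule comm_inv_char) (use that in auto)
qed

section \<open>Splitting fields as least subfields, and their automorphisms\<close>

lemma splitting_field_minimal:
  assumes "range to_ac \<subseteq> M" "roots_ac f \<subseteq> M"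
    and "\<And>x. x \<in> M \<Longrightarrow> - x \<in> M" "\<And>x. x \<in> M \<Longrightarrow> inverse x \<in> M"
    and "\<And>x y. x \<in> M \<Longrightarrow> y \<in> M \<Longrightarrow> x + y \<in> M" "\<And>x y. x \<in> M \<Longrightarrow> y \<in> M \<Longrightarrow> x * y \<in> M"
  shows "splitting_field f \<subseteq> M"
proof
  fix x assume "x \<in> splitting_field f"
  then show "x \<in> M"
    unfolding splitting_field_def
  proof (induction rule: generate_field.induct)
    case one
    then show ?case using assms(1) by (metis range_subsetD ring_of_type_algebra_simps(2) to_ac_1)
  qed (use assms in auto)
qed

lemma
  shows to_ac_splitting_field: "to_ac c \<in> splitting_field f"
    and roots_subset_splitting_field: "roots_ac f \<subseteq> splitting_field f"
    and splitting_field_uminus: "x \<in> splitting_field f \<Longrightarrow> - x \<in> splitting_field f"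
    and splitting_field_add: "x \<in> splitting_field f \<Longrightarrow> y \<in> splitting_field f \<Longrightarrow> x + y \<in> splitting_field f"
    and splitting_field_mult: "x \<in> splitting_field f \<Longrightarrow> y \<in> splitting_field f \<Longrightarrow> x * y \<in> splitting_field f"
  unfolding splitting_field_def
  by (blast intro: generate_field.incl)+
    (metis generate_field.a_inv a_inv_ring_of_type_algebra, metis generate_field.eng_add ring_of_type_algebra_simps(4),
     metis generate_field.eng_mult ring_of_type_algebra_simps(5))

lemma splitting_field_inverse: "x \<in> splitting_field f \<Longrightarrow> inverse x \<in> splitting_field f"
  using generate_field.m_inv[of x ring_of_type_algebra "range to_ac \<union> roots_ac f"]
  by (cases "x = 0") (simp_all add: splitting_field_def)

text \<open>Bridge from the record-based definition to \<open>algebra_hom\<close>, so that the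
  results on partial homomorphisms apply to automorphisms.\<close>

lemma mem_galois_group_iff:
  "\<sigma> \<in> carrier (galois_group f) \<longleftrightarrow>
     algebra_hom (splitting_field f) \<sigma> \<and> \<sigma> \<in> Bij (splitting_field f)"
proof -
  let ?S = "splitting_field f"
  have "to_ac 1 \<in> ?S" by (rule to_ac_splitting_field)
  then have one: "1 \<in> ?S" by simp
  have "\<sigma> \<in> carrier (galois_group f) \<longleftrightarrow> (\<forall>x\<in>?S. \<sigma> x \<in> ?S) \<and>
      (\<forall>x\<in>?S. \<forall>y\<in>?S. \<sigma> (x + y) = \<sigma> x + \<sigma> y \<and> \<sigma> (x * y) = \<sigma> x * \<sigma> y) \<and> \<sigma> 1 = 1 \<and>
      bij_betw \<sigma> ?S ?S \<and> \<sigma> \<in> extensional ?S \<and> (\<forall>c. \<sigma> (to_ac c) = to_ac c)"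
    by (auto simp: galois_group_def splitting_ring_def ring_iso_def ring_hom_def)
  moreover have "algebra_hom ?S \<sigma> \<longleftrightarrow>
      (\<forall>x\<in>?S. \<forall>y\<in>?S. \<sigma> (x + y) = \<sigma> x + \<sigma> y \<and> \<sigma> (x * y) = \<sigma> x * \<sigma> y) \<and> \<sigma> 1 = 1 \<and>
      (\<forall>c. \<sigma> (to_ac c) = to_ac c)"
    by (auto simp: algebra_hom_def algebra_hom_axioms_def hom_on_def one to_ac_splitting_field
        splitting_field_add splitting_field_mult splitting_field_uminus)
  ultimately show ?thesis
    by (auto simp: Bij_def dest: bij_betwE)
qed

lemma group_galois_group: "group (galois_group f)"
proof -
  let ?S = "splitting_field f" and ?G = "carrier (galois_group f)"
  have Bij: "\<sigma> \<in> Bij ?S" and mem: "x \<in> ?S \<Longrightarrow> \<sigma> x \<in> ?S" if "\<sigma> \<in> ?G" for \<sigma> x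
    using that Bij_imp_funcset by (auto simp: mem_galois_group_iff)
  have "subgroup ?G (BijGroup ?S)"
  proof
    show "?G \<subseteq> carrier (BijGroup ?S)"
      by (auto simp: mem_galois_group_iff BijGroup_def)
  next
    fix \<sigma> \<tau> assume st: "\<sigma> \<in> ?G" "\<tau> \<in> ?G"
    then interpret s: algebra_hom ?S \<sigma> by (simp add: mem_galois_group_iff)
    from st interpret t: algebra_hom ?S \<tau> by (simp add: mem_galois_group_iff)
    have "algebra_hom ?S (compose ?S \<sigma> \<tau>)"
      by standard (auto simp: compose_eq t.hom_one s.hom_one t.hom_add s.hom_add t.hom_mult s.hom_mult
          t.hom_to_ac s.hom_to_ac mem st s.one_mem s.add_mem s.mult_mem s.uminus_mem s.to_ac_mem)
    then show "\<sigma> \<otimes>\<^bsub>BijGroup ?S\<^esub> \<tau> \<in> ?G"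
      using st by (simp add: mem_galois_group_iff BijGroup_def compose_Bij)
  next
    have "algebra_hom ?S (\<lambda>x\<in>?S. x)"
      using to_ac_splitting_field[of 1 f] to_ac_splitting_field[of _ f]
      by unfold_locales (auto intro: splitting_field_add splitting_field_mult splitting_field_uminus)
    then show "\<one>\<^bsub>BijGroup ?S\<^esub> \<in> ?G"
      by (simp add: mem_galois_group_iff BijGroup_def id_Bij)
  next
    fix \<sigma> assume s: "\<sigma> \<in> ?G"
    then interpret s: algebra_hom ?S \<sigma> by (simp add: mem_galois_group_iff)
    let ?\<tau> = "\<lambda>x\<in>?S. inv_into ?S \<sigma> x"
    have inv: "inv_into ?S \<sigma> (\<sigma> x) = x" if "x \<in> ?S" for x
      using Bij[OF s] that by (simp add: Bij_def bij_betw_def)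
    have "algebra_hom ?S ?\<tau>"
    proof
      show "?\<tau> 1 = 1"
        using inv[OF s.one_mem] by (simp add: s.hom_one s.one_mem)
      show "?\<tau> (to_ac c) = to_ac c" for c
        using inv[OF s.to_ac_mem] by (simp add: s.hom_to_ac s.to_ac_mem)
      fix x y assume "x \<in> ?S" "y \<in> ?S"
      then show "?\<tau> (x + y) = ?\<tau> x + ?\<tau> y" "?\<tau> (x * y) = ?\<tau> x * ?\<tau> y"
        by (auto simp: s.add_mem s.mult_mem s.hom_add s.hom_mult intro!: Bij_inv_into_lemma Bij s)
    qed (auto intro: s.add_mem s.mult_mem s.uminus_mem s.to_ac_mem s.one_mem)
    then show "inv\<^bsub>BijGroup ?S\<^esub> \<sigma> \<in> ?G"
      using Bij[OF s] by (simp add: mem_galois_group_iff inv_BijGroup restrict_inv_into_Bij)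
  qed
  from subgroup.subgroup_is_group[OF this group_BijGroup] show ?thesis
    by (simp add: galois_group_def)
qed

lemma finite_roots_ac: "f \<noteq> 0 \<Longrightarrow> finite (roots_ac f)"
  unfolding roots_ac_def by (rule poly_roots_finite) (simp add: map_poly_eq_0_iff)

lemma (in algebra_hom) image_roots_ac:
  assumes "f \<noteq> 0" "roots_ac f \<subseteq> L"
  shows "\<phi> ` roots_ac f = roots_ac f"
  using assms root_hom
  by (intro endo_inj_surj finite_roots_ac) (auto intro: inj_on_subset[OF inj])

lemma group_action_galois_action:
  assumes "f \<noteq> 0"
  shows "group_action (galois_group f) (roots_ac f) (galois_action f)"
proof -
  let ?S = "splitting_field f" and ?G = "galois_group f" and ?E = "roots_ac f"
  have Bij: "galois_action f \<sigma> \<in> Bij ?E" if "\<sigma> \<in> carrier ?G" for \<sigma>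
  proof -
    interpret algebra_hom ?S \<sigma> using that by (simp add: mem_galois_group_iff)
    show ?thesis
      using image_roots_ac[OF assms roots_subset_splitting_field]
        inj_on_subset[OF inj roots_subset_splitting_field]
      by (simp add: Bij_def galois_action_def bij_betw_def)
  qed
  have "galois_action f (\<sigma> \<otimes>\<^bsub>?G\<^esub> \<tau>) = galois_action f \<sigma> \<otimes>\<^bsub>BijGroup ?E\<^esub> galois_action f \<tau>"
    if "\<sigma> \<in> carrier ?G" "\<tau> \<in> carrier ?G" for \<sigma> \<tau>
  proof -
    interpret algebra_hom ?S \<tau> using that by (simp add: mem_galois_group_iff)
    have "\<sigma> \<otimes>\<^bsub>?G\<^esub> \<tau> = compose ?S \<sigma> \<tau>"
    proof -
      have "\<sigma> \<in> Bij ?S" "\<tau> \<in> Bij ?S"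
        using that by (auto simp: mem_galois_group_iff)
      then show ?thesis by (simp add: galois_group_def BijGroup_def)
    qed
    moreover have "\<tau> x \<in> ?E" if "x \<in> ?E" for x
      using root_hom that roots_subset_splitting_field by blast
    ultimately show ?thesis
      using Bij that roots_subset_splitting_field[of f]
      by (auto simp: BijGroup_def galois_action_def compose_def fun_eq_iff)
  qed
  then show ?thesis
    using Bij by (auto simp: group_action_def group_hom_def group_hom_axioms_def hom_def
        group_galois_group group_BijGroup) (auto simp: BijGroup_def)
qed

text \<open>After extension to a field containing all roots, the map permutes the roots; minimality
  of the splitting field then makes it an automorphism there.\<close>

lemma (in algebra_hom) extend_to_galois_group:
  assumes "f \<noteq> 0"
  obtains \<sigma> where "\<sigma> \<in> carrier (galois_group f)"
    "\<And>x. x \<in> L \<Longrightarrow> x \<in> splitting_field f \<Longrightarrow> \<sigma> x = \<phi> x"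
proof -
  let ?S = "splitting_field f"
  obtain M \<psi> where "algebra_hom M \<psi>" "roots_ac f \<subseteq> M" and ext: "\<And>x. x \<in> L \<Longrightarrow> \<psi> x = \<phi> x"
    using extend_finite[OF finite_roots_ac[OF assms]] by metis
  then interpret M: algebra_hom M \<psi> by simp
  have roots: "\<psi> ` roots_ac f = roots_ac f"
    by (rule M.image_roots_ac) fact+
  have hom_inverse: "\<psi> (inverse x) = inverse (\<psi> x)" if "x \<in> M" for x
  proof (cases "x = 0")
    case False
    then have "\<psi> x * \<psi> (inverse x) = 1"
      using that by (simp add: M.inverse_mem M.hom_one flip: M.hom_mult)
    then show ?thesis by (metis inverse_unique)
  qed (simp add: M.hom_zero)
  \<comment> \<open>The elements that \<open>\<psi>\<close> sends into the splitting field form a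
    field containing the base field and all roots.\<close>
  have "?S \<subseteq> {x \<in> M. \<psi> x \<in> ?S}"
    using roots \<open>roots_ac f \<subseteq> M\<close> roots_subset_splitting_field[of f]
    by (intro splitting_field_minimal)
       (auto simp: M.hom_to_ac to_ac_splitting_field M.hom_add M.hom_mult M.hom_uminus hom_inverse
         intro: M.to_ac_mem M.add_mem M.mult_mem M.uminus_mem M.inverse_mem splitting_field_add
           splitting_field_mult splitting_field_uminus splitting_field_inverse)
  then have sub: "?S \<subseteq> M" "\<psi> ` ?S \<subseteq> ?S" by auto
  \<comment> \<open>Surjectivity: the image is again a field containing the base field and all
    roots.\<close>
  have "?S \<subseteq> \<psi> ` ?S"
  proof (rule splitting_field_minimal)
    show "range to_ac \<subseteq> \<psi> ` ?S"
      using M.hom_to_ac to_ac_splitting_field[of _ f] by (metis image_subsetI rev_image_eqI)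
    show "roots_ac f \<subseteq> \<psi> ` ?S"
      using roots roots_subset_splitting_field[of f] by blast
    fix x y assume "x \<in> \<psi> ` ?S" "y \<in> \<psi> ` ?S"
    then obtain u v where uv: "u \<in> ?S" "v \<in> ?S" "x = \<psi> u" "y = \<psi> v" by blast
    then have "u \<in> M" "v \<in> M" using sub by auto
    then have "- x = \<psi> (- u)" "inverse x = \<psi> (inverse u)" "x + y = \<psi> (u + v)" "x * y = \<psi> (u * v)"
      using uv by (auto simp: M.hom_uminus hom_inverse M.hom_add M.hom_mult)
    then show "- x \<in> \<psi> ` ?S" "inverse x \<in> \<psi> ` ?S" "x + y \<in> \<psi> ` ?S" "x * y \<in> \<psi> ` ?S"
      using uv by (auto intro!: imageI splitting_field_add
           splitting_field_mult splitting_field_uminus splitting_field_inverse)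
  qed
  then have "restrict \<psi> ?S \<in> Bij ?S"
    using sub inj_on_subset[OF M.inj sub(1)] by (auto simp: Bij_def bij_betw_def)
  moreover have "algebra_hom ?S (restrict \<psi> ?S)"
    using to_ac_splitting_field[of 1 f] to_ac_splitting_field[of _ f] sub(1)
    by unfold_locales
       (auto simp: subset_iff M.hom_one M.hom_add M.hom_mult M.hom_to_ac
         intro: splitting_field_add splitting_field_mult splitting_field_uminus)
  ultimately show ?thesis
    using that[of "restrict \<psi> ?S"] ext by (simp add: mem_galois_group_iff)
qed

text \<open>Let a block contain two points x and y. An element fixing x maps the block to a set
  meeting it, hence to itself; as such elements carry y to any other point, the block is
  everything.\<close>

lemma primitive_action_if_doubly_transitive:
  assumes "transitive_action G E \<phi>" and "E \<noteq> {}"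
    and two: "\<And>x y z. x \<in> E \<Longrightarrow> y \<in> E - {x} \<Longrightarrow> z \<in> E - {x} \<Longrightarrow> \<exists>g\<in>carrier G. \<phi> g x = x \<and> \<phi> g y = z"
  shows "primitive_action G E \<phi>"
proof -
  interpret transitive_action G E \<phi> by fact
  show ?thesis
  proof
    fix B assume "is_block G E \<phi> B"
    then have B: "B \<subseteq> E" "B \<noteq> {}" and block: "\<And>g. g \<in> carrier G \<Longrightarrow> \<phi> g ` B = B \<or> \<phi> g ` B \<inter> B = {}"
      by (auto simp: is_block_def)
    obtain x where x: "x \<in> B" using B by blast
    show "(\<exists>x. B = {x}) \<or> B = E"
    proof (cases "B = {x}")
      case False
      then obtain y where y: "y \<in> B" "y \<noteq> x" using x by blast
      have "z \<in> B" if "z \<in> E" for z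
      proof (cases "z = x")
        case False
        have "\<exists>g\<in>carrier G. \<phi> g x = x \<and> \<phi> g y = z"
          by (rule two) (use x y B that False in auto)
        then obtain g where "g \<in> carrier G" "\<phi> g x = x" "\<phi> g y = z"
          by blast
        then show ?thesis
          using block[of g] x y by (metis disjoint_iff imageI)
      qed (use x in simp)
      then show ?thesis using B by blast
    qed blast
  qed fact
qed

subsection \<open>Irreducible polynomials over a polynomial ring\<close>

text \<open>The scalar \<open>d\<close> makes this a statement about irreducibility over the field of fractions.\<close>

lemma reverse_Eisenstein:
  fixes Q U V :: "'a::field poly poly"
  assumes const: "poly (coeff Q 0) a \<noteq> 0" and rest: "\<And>i. i > 0 \<Longrightarrow> poly (coeff Q i) a = 0"
    and lead: "lead_coeff Q = [:-a, 1:] * l" "poly l a \<noteq> 0"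
    and "d \<noteq> 0" "smult d Q = U * V"
  shows "degree U = 0 \<or> degree V = 0"
  using \<open>d \<noteq> 0\<close> \<open>smult d Q = U * V\<close>
proof (induction "degree d" arbitrary: d U V rule: less_induct)
  case less
  define ev where "ev = map_poly (\<lambda>c. poly c a)"
  interpret ev: hom_on UNIV "\<lambda>c. poly c a"
    by standard auto
  have coeff_ev: "coeff (ev p) i = poly (coeff p i) a" for p i
    by (simp add: ev_def coeff_map_poly)
  \<comment> \<open>Modulo the prime \<open>[:-a, 1:]\<close> only the constant coefficient of
    \<open>Q\<close> survives.\<close>
  have "ev (smult d Q) = [: poly d a * poly (coeff Q 0) a :]"
    using rest by (intro poly_eqI) (simp add: coeff_ev coeff_pCons split: nat.split)
  then have ev: "ev U * ev V = [: poly d a * poly (coeff Q 0) a :]"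
    using less.prems ev.map_poly_mult[of U V] by (simp add: ev_def)
  show ?case
  proof (cases "poly d a = 0")
    \<comment> \<open>Both reductions divide a nonzero constant, so they are constants. If
      \<open>U\<close> and \<open>V\<close> both had positive degree, the prime would divide both
      leading coefficients, and its square would divide \<open>d * lead_coeff Q\<close>, although
      neither \<open>d\<close> nor \<open>l\<close> vanishes at \<open>a\<close>.\<close>
    case False
    then have nz: "ev U * ev V \<noteq> 0"
      using ev const by simp
    then have "degree (ev U) + degree (ev V) = 0"
      using ev by (metis degree_mult_eq degree_pCons_0 mult_zero_left mult_zero_right)
    then have *: "i > 0 \<Longrightarrow> poly (coeff U i) a = 0 \<and> poly (coeff V i) a = 0" for i
      using coeff_eq_0[of "ev U" i] coeff_eq_0[of "ev V" i] by (simp add: coeff_ev)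
    show ?thesis
    proof (rule ccontr)
      assume "\<not> ?thesis"
      then have "[:-a, 1:] dvd lead_coeff U" "[:-a, 1:] dvd lead_coeff V"
        using * by (auto simp: dvd_iff_poly_eq_0)
      then obtain u v where "lead_coeff U = [:-a, 1:] * u" "lead_coeff V = [:-a, 1:] * v"
        by (auto elim!: dvdE)
      moreover have "d * lead_coeff Q = lead_coeff U * lead_coeff V"
        using less.prems(2) lead_coeff_mult[of U V] lead_coeff_smult[of d Q] by simp
      ultimately have "[:-a, 1:] * (d * l) = [:-a, 1:] * ([:-a, 1:] * (u * v))"
        unfolding lead(1) by (simp only: mult_ac)
      then have "d * l = [:-a, 1:] * (u * v)"
        by (subst (asm) mult_left_cancel) auto
      then have "poly (d * l) a = 0"
        by simp
      then show False
        using False lead by simp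
    qed
  next
    \<comment> \<open>As in Gauss's lemma, the prime divides \<open>d\<close>, hence all of
      \<open>U\<close> or all of \<open>V\<close>. Cancelling it lowers the degree of
      \<open>d\<close> and keeps the degrees of the factors.\<close>
    case True
    then obtain d' where d': "d = [:-a, 1:] * d'"
      by (auto simp: poly_eq_0_iff_dvd elim!: dvdE)
    then have "d' \<noteq> 0"
      using less.prems by auto
    then have deg: "degree d' < degree d"
      using degree_mult_eq[of "[:-a, 1:]" d'] d' by simp
    have split: "\<exists>W'. W = smult [:-a, 1:] W'" if "ev W = 0" for W
    proof -
      have "poly (coeff W i) a = 0" for i
        using that coeff_ev[of W i] by simp
      then have "[:[:-a, 1:]:] dvd W"
        by (simp add: const_poly_dvd_iff dvd_iff_poly_eq_0)
      then show ?thesis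
        by (auto elim!: dvdE)
    qed
    have "ev U = 0 \<or> ev V = 0"
      using ev True by simp
    then obtain U' V' where UV: "U * V = smult [:-a, 1:] (U' * V')"
      and deg_UV: "degree U = degree U'" "degree V = degree V'"
    proof (elim disjE)
      assume "ev U = 0"
      then obtain U' where "U = smult [:-a, 1:] U'"
        using split by blast
      then show ?thesis
        by (intro that[of U' V]) auto
    next
      assume "ev V = 0"
      then obtain V' where "V = smult [:-a, 1:] V'"
        using split by blast
      then show ?thesis
        by (intro that[of U V']) auto
    qed
    have "smult [:-a, 1:] (smult d' Q) = smult [:-a, 1:] (U' * V')"
      using less.prems(2) unfolding UV d' smult_smult .
    then have "smult d' Q = U' * V'"
      unfolding eq_iff_diff_eq_0[of "smult [:-a, 1:] _"] smult_diff_right[symmetric] by simp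
    then show ?thesis
      using less.hyps[OF deg \<open>d' \<noteq> 0\<close>] deg_UV by simp
  qed
qed

text \<open>A kernel element \<open>g\<close> of least degree divides every kernel element up to a
  scalar, by pseudo-division. In particular it divides \<open>Q\<close>, and irreducibility makes
  \<open>Q\<close> and \<open>g\<close> agree up to scalars.\<close>

lemma kernel_multiple_of_irreducible:
  fixes Q f :: "'r::idom poly" and h :: "'r poly \<Rightarrow> 's::field"
  assumes "hom_on UNIV h" and inj: "\<And>c. h [:c:] = 0 \<Longrightarrow> c = 0"
    and irred: "\<And>d U V. d \<noteq> 0 \<Longrightarrow> smult d Q = U * V \<Longrightarrow> degree U = 0 \<or> degree V = 0"
    and "Q \<noteq> 0" "h Q = 0" "h f = 0"
  shows "\<exists>d k. d \<noteq> 0 \<and> smult d f = Q * k"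
proof -
  interpret hom_on UNIV h by fact
  have h_smult: "h (smult c p) = h [:c:] * h p" for c p
    using hom_mult[of "[:c:]" p] by simp
  obtain g where g: "g \<noteq> 0" "h g = 0" and min: "\<And>p. p \<noteq> 0 \<Longrightarrow> h p = 0 \<Longrightarrow> degree g \<le> degree p"
    using arg_min_nat_lemma[of "\<lambda>p. p \<noteq> 0 \<and> h p = 0" Q degree] \<open>Q \<noteq> 0\<close> \<open>h Q = 0\<close> by metis
  have mult: "\<exists>d k. d \<noteq> 0 \<and> smult d p = g * k" if "h p = 0" for p
  proof -
    obtain d k where dk: "d \<noteq> 0" "smult d p = g * k + pseudo_mod p g"
      using pseudo_mod(1)[OF g(1)] by blast
    then have "pseudo_mod p g = smult d p - g * k" by simp
    then have "h (pseudo_mod p g) = 0"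
      using that g by (simp add: hom_diff hom_mult h_smult)
    then have "pseudo_mod p g = 0"
      using pseudo_mod(2)[OF g(1), of p] min[of "pseudo_mod p g"] by linarith
    with dk show ?thesis by auto
  qed
  obtain d k where dk: "d \<noteq> 0" "smult d Q = g * k"
    using mult[OF \<open>h Q = 0\<close>] by blast
  \<comment> \<open>Since \<open>h\<close> is injective on constants, \<open>g\<close> is not
    constant, so the constant factor of \<open>smult d Q\<close> has to be \<open>k\<close>.\<close>
  have "degree g \<noteq> 0"
  proof
    assume "degree g = 0"
    then obtain c where "g = [:c:]" by (rule degree_eq_zeroE)
    then show False using g inj[of c] by auto
  qed
  then obtain c where c: "k = [:c:]"
    using irred[OF dk] by (auto elim!: degree_eq_zeroE)
  then have "c \<noteq> 0"
    using dk \<open>Q \<noteq> 0\<close> by auto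
  obtain e q where eq: "e \<noteq> 0" "smult e f = g * q"
    using mult[OF \<open>h f = 0\<close>] by blast
  have "smult (c * e) f = smult c (g * q)"
    using eq by (simp flip: smult_smult)
  also have "\<dots> = (g * k) * q"
    by (simp add: c)
  also have "\<dots> = Q * smult d q"
    by (simp flip: dk)
  finally show ?thesis
    using \<open>c \<noteq> 0\<close> eq by (intro exI[of _ "c * e"] exI[of _ "smult d q"]) simp
qed

subsection \<open>Double transitivity\<close>

lemma finite_poly_degree_le: "finite {p :: 'a::{zero,finite} poly. degree p \<le> n}"
proof (rule finite_subset)
  show "{p :: 'a poly. degree p \<le> n} \<subseteq> Poly ` {xs. set xs \<subseteq> UNIV \<and> length xs \<le> Suc n}"
  proof
    fix p :: "'a poly" assume "p \<in> {p. degree p \<le> n}"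
    then have "length (coeffs p) \<le> Suc n"
      by (cases "p = 0") (auto simp: length_coeffs_degree)
    then show "p \<in> Poly ` {xs. set xs \<subseteq> UNIV \<and> length xs \<le> Suc n}"
      by (intro image_eqI[of _ _ "coeffs p"]) auto
  qed
  show "finite (Poly ` {xs :: 'a list. set xs \<subseteq> UNIV \<and> length xs \<le> Suc n})"
    by (intro finite_imageI finite_lists_length_le) auto
qed

section \<open>Constants, the variable t, and evaluation in the closure of F_q(t)\<close>

abbreviation const_ac :: "'a::field \<Rightarrow> 'a poly fract alg_closure" where
  "const_ac c \<equiv> to_ac (rf_const c)"

abbreviation var_ac :: "'a::field poly fract alg_closure" where
  "var_ac \<equiv> to_ac rf_var"

lemma rf_const_simps [simp]:
  "rf_const 0 = 0" "rf_const 1 = 1" "rf_const (- c) = - rf_const c"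
  "rf_const (c + d) = rf_const c + rf_const d" "rf_const (c * d) = rf_const c * rf_const d"
  by (simp_all add: rf_const_def flip: to_fract_uminus to_fract_add to_fract_mult)
     (metis one_pCons to_fract_1)

lemma hom_on_const_ac: "hom_on UNIV const_ac"
  by standard auto

text \<open>Turns equal kernels into a homomorphism over F_q(t). The elements \<open>k c\<close>
  represent the constants, and \<open>u\<close>, \<open>v\<close> represent t as a fraction in the
  same way under \<open>h\<close> and \<open>h'\<close>, so the induced map has to fix t.\<close>

lemma algebra_hom_fractions:
  fixes h h' :: "'r::comm_ring_1 \<Rightarrow> 'a::field poly fract alg_closure"
  assumes h: "hom_on UNIV h" and h': "hom_on UNIV h'" and ker: "\<And>r. h r = 0 \<longleftrightarrow> h' r = 0"
    and const: "\<And>c. h (k c) = const_ac c" "\<And>c. h' (k c) = const_ac c"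
    and var: "h v \<noteq> 0" "h u = var_ac * h v" "h' u = var_ac * h' v"
  obtains L \<phi> where "algebra_hom L \<phi>" "\<And>r. h r \<in> L" "\<And>r. \<phi> (h r) = h' r"
proof -
  obtain \<phi>0 where \<phi>0: "hom_on (range h) \<phi>0" "\<And>r. \<phi>0 (h r) = h' r"
    using hom_on_factor[OF h h'] ker by auto
  have inj: "x = 0" if "x \<in> range h" "\<phi>0 x = 0" for x
    using that \<phi>0(2) ker by auto
  obtain L \<phi> where "hom_on L \<phi>" and L: "range h \<subseteq> L" "\<And>x. x \<in> range h \<Longrightarrow> \<phi> x = \<phi>0 x"
      and inverse_mem: "\<And>x. x \<in> L \<Longrightarrow> inverse x \<in> L"
  proof (rule hom_on_fractions[OF \<phi>0(1)])
    show "x = 0" if "x \<in> range h" "\<phi>0 x = 0" for x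
      using that by (rule inj)
  qed (rule that)
  then interpret hom_on L \<phi> by simp
  have mem: "h r \<in> L" and \<phi>: "\<phi> (h r) = h' r" for r
    using L \<phi>0 by auto
  \<comment> \<open>\<open>P\<close> holds for the constants and for t and is preserved by sums,
    products and quotients, hence it holds on all of F_q(t).\<close>
  define P where "P c \<longleftrightarrow> to_ac c \<in> L \<and> \<phi> (to_ac c) = to_ac c" for c
  have div: "x / y \<in> L \<and> \<phi> (x / y) = \<phi> x / \<phi> y" if "x \<in> L" "y \<in> L" for x y
  proof (cases "y = 0")
    case False
    have mem: "x / y \<in> L"
      using that mult_mem[OF that(1) inverse_mem] by (simp add: divide_inverse)
    then have "\<phi> (x / y) * \<phi> y = \<phi> x"
      using that False by (simp flip: hom_mult)
    moreover have "\<phi> y \<noteq> 0"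
      using inj_on_eq_iff[OF hom_on_inj[OF hom_on_axioms inverse_mem] that(2) zero_mem] False
      by (simp add: hom_zero)
    ultimately show ?thesis
      using mem by (simp add: field_simps)
  qed (simp add: hom_zero zero_mem)
  have add: "P (c + d)" and mult: "P (c * d)" and divide: "P (c / d)" if "P c" "P d" for c d
    using that div by (auto simp: P_def hom_add hom_mult add_mem mult_mem)
  have const: "P (rf_const c)" for c
    using mem[of "k c"] \<phi>[of "k c"] const by (simp add: P_def)
  have "h' v \<noteq> 0"
    using var ker by simp
  then have "h u / h v = var_ac" "\<phi> (h u) / \<phi> (h v) = var_ac"
    unfolding \<phi> using var by simp_all
  then have var: "P rf_var"
    using div[OF mem mem, of u v] by (simp add: P_def)
  have "P (to_fract p)" for p
  proof (induction p)
    case 0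
    then show ?case using const[of 0] by (simp add: rf_const_def)
  next
    case (pCons c p)
    have "to_fract (pCons c p) = rf_const c + rf_var * to_fract p"
      by (simp add: rf_const_def rf_var_def flip: to_fract_add to_fract_mult)
    then show ?case
      using pCons add mult const var by simp
  qed
  then have "P c" for c
    by (cases c) (auto simp: Fract_conv_to_fract intro!: divide)
  then have "algebra_hom L \<phi>"
    by unfold_locales (auto simp: P_def)
  with mem \<phi> that show ?thesis by blast
qed

definition eval_ac :: "'a::field poly fract alg_closure \<Rightarrow> 'a poly \<Rightarrow> 'a poly fract alg_closure" where
  "eval_ac x p = poly (map_poly const_ac p) x"

lemma hom_on_eval_ac: "hom_on UNIV (eval_ac x)"
  using hom_on.hom_on_eval[OF hom_on_const_ac, of x] by (simp add: eval_ac_def[abs_def])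

lemma eval_ac_0 [simp]: "eval_ac x 0 = 0"
  by (simp add: eval_ac_def)

lemma eval_ac_pCons: "eval_ac x (pCons c p) = const_ac c + x * eval_ac x p"
  by (simp add: eval_ac_def map_poly_pCons)

lemma eval_ac_const [simp]: "eval_ac x [:c:] = const_ac c"
  by (simp add: eval_ac_pCons)

lemma eval_ac_var: "eval_ac x [:0, 1:] = x"
  by (simp add: eval_ac_pCons)

lemma eval_ac_linear: "eval_ac x [:- a, 1:] = x - const_ac a"
  by (simp add: eval_ac_pCons)

text \<open>The inner variable goes to \<open>x\<close> and the outer one to \<open>y\<close>, so
  the coefficient ring plays the part of F_q[x].\<close>

definition eval2_ac ::
    "'a::field poly fract alg_closure \<Rightarrow> 'a poly fract alg_closure \<Rightarrow> 'a poly poly \<Rightarrow> 'a poly fract alg_closure" where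
  "eval2_ac x y p = poly (map_poly (eval_ac x) p) y"

lemma hom_on_eval2_ac: "hom_on UNIV (eval2_ac x y)"
  using hom_on.hom_on_eval[OF hom_on_eval_ac, of x y] by (simp add: eval2_ac_def[abs_def])

lemma eval2_ac_const [simp]: "eval2_ac x y [:p:] = eval_ac x p"
  by (simp add: eval2_ac_def map_poly_pCons)

lemma eval2_ac_monom [simp]: "eval2_ac x y (monom p i) = eval_ac x p * y ^ i"
  by (simp add: eval2_ac_def map_poly_monom poly_monom)

lemma mem_roots_F_poly_iff:
  "x \<in> roots_ac (F_poly m a b) \<longleftrightarrow> x ^ m - const_ac b = var_ac * (x - const_ac a)"
proof -
  interpret hom_on UNIV "to_ac :: 'a poly fract \<Rightarrow> _" by (rule hom_on_to_ac)
  have "F_poly m a b = monom 1 m + [:rf_var * rf_const a - rf_const b, - rf_var:]"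
    by (simp add: F_poly_def monom_altdef)
  then have "poly (map_poly to_ac (F_poly m a b)) x
      = x ^ m - const_ac b - var_ac * (x - const_ac a)"
    by (simp add: map_poly_add map_poly_monom poly_monom map_poly_pCons algebra_simps)
  then show ?thesis
    by (simp add: roots_ac_def)
qed

lemma rf_var_power: "rf_var ^ n = to_fract (monom 1 n)"
  by (induction n) (auto simp: rf_var_def monom_Suc monom_0 simp flip: to_fract_mult one_pCons)

lemma F_poly_has_root:
  assumes "m > 0"
  shows "roots_ac (F_poly m a b) \<noteq> {}" and "F_poly m a b \<noteq> 0"
proof -
  have F: "F_poly m a b = monom 1 m + [:rf_var * rf_const a - rf_const b, - rf_var:]"
    by (simp add: F_poly_def monom_altdef)
  \<comment> \<open>Needed for \<open>m = 1\<close>, where the leading coefficient is 1 - t.\<close>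
  have "rf_var \<noteq> (1 :: 'a poly fract)"
  proof
    assume "rf_var = (1 :: 'a poly fract)"
    then have "to_fract [:0, 1 :: 'a:] = to_fract 1"
      unfolding rf_var_def by simp
    then show False
      unfolding to_fract_eq_iff by (simp add: one_pCons)
  qed
  then have "coeff (F_poly m a b) m \<noteq> 0"
    unfolding F using assms by (cases m) (auto simp: coeff_pCons split: nat.splits)
  then show "F_poly m a b \<noteq> 0" by auto
  from \<open>coeff (F_poly m a b) m \<noteq> 0\<close> have "degree (map_poly to_ac (F_poly m a b)) \<ge> m"
    by (intro le_degree) (simp add: coeff_map_poly)
  then show "roots_ac (F_poly m a b) \<noteq> {}"
    using alg_closed_imp_poly_has_root[of "map_poly to_ac (F_poly m a b)"] assms
    by (auto simp: roots_ac_def)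
qed

section \<open>The roots of \<open>F_poly m a b\<close> over a finite field of constants\<close>

context
  fixes a b :: "'a::{field,finite}" and m :: nat
  assumes m: "m > 0" and ab: "b \<noteq> a ^ m"
begin

text \<open>At \<open>a\<close> the root equation would read a^m = b. Hence x - a may serve as the
  denominator of t.\<close>

lemma root_neq_const:
  assumes "x \<in> roots_ac (F_poly m a b)"
  shows "x \<noteq> const_ac a"
proof
  interpret hom_on UNIV "const_ac :: 'a \<Rightarrow> _" by (rule hom_on_const_ac)
  assume "x = const_ac a"
  then have "const_ac (a ^ m) = const_ac b"
    using assms by (simp add: mem_roots_F_poly_iff hom_power)
  then show False
    using ab by (simp add: rf_const_def)
qed

lemma eval_ac_root:
  assumes "x \<in> roots_ac (F_poly m a b)"
  shows "eval_ac x ([:0, 1:] ^ m - [:b:]) = var_ac * eval_ac x [:-a, 1:]" "eval_ac x [:-a, 1:] \<noteq> 0"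
proof -
  interpret hom_on UNIV "eval_ac x" by (rule hom_on_eval_ac)
  show "eval_ac x ([:0, 1:] ^ m - [:b:]) = var_ac * eval_ac x [:-a, 1:]"
    using assms by (simp add: hom_diff hom_power eval_ac_var eval_ac_linear mem_roots_F_poly_iff)
  show "eval_ac x [:-a, 1:] \<noteq> 0"
    using root_neq_const[OF assms] by (simp add: eval_ac_linear)
qed

text \<open>If a root \<open>x\<close> were algebraic over the finite field of constants, then the constants and \<open>x\<close>
  would generate a finite ring, and by pigeonhole \<open>t\<close> would be a root of unity.\<close>

lemma root_transcendental:
  assumes x: "x \<in> roots_ac (F_poly m a b)" and g: "eval_ac x g = 0"
  shows "g = 0"
proof (rule ccontr)
  assume "g \<noteq> 0"
  interpret hom_on UNIV "eval_ac x" by (rule hom_on_eval_ac)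
  \<comment> \<open>Reduction modulo \<open>g\<close> does not change the value at \<open>x\<close>
    and bounds the degree.\<close>
  have "range (eval_ac x) \<subseteq> eval_ac x ` {p. degree p \<le> degree g}"
  proof clarify
    fix p
    have "eval_ac x p = eval_ac x (p div g * g + p mod g)"
      by simp
    also have "\<dots> = eval_ac x (p mod g)"
      unfolding hom_add[OF UNIV_I UNIV_I] hom_mult[OF UNIV_I UNIV_I] by (simp add: g)
    finally show "eval_ac x p \<in> eval_ac x ` {p. degree p \<le> degree g}"
      using degree_mod_less[OF \<open>g \<noteq> 0\<close>, of p] by force
  qed
  then have "finite (range (eval_ac x))"
    using finite_poly_degree_le finite_surj by blast
  define u :: "'a poly" where "u = [:0, 1:] ^ m - [:b:]"
  define v :: "'a poly" where "v = [:-a, 1:]"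
  have uv: "eval_ac x u = var_ac * eval_ac x v" "eval_ac x v \<noteq> 0"
    using eval_ac_root[OF x] by (simp_all add: u_def v_def)
  \<comment> \<open>Only the numerator and the denominator of t are known to lie in the finite ring,
    so their powers are matched simultaneously; division then gives equal powers of t.\<close>
  have "range (\<lambda>n. (eval_ac x (u ^ n), eval_ac x (v ^ n))) \<subseteq> range (eval_ac x) \<times> range (eval_ac x)"
    by auto
  then have "finite (range (\<lambda>n. (eval_ac x (u ^ n), eval_ac x (v ^ n))))"
    using \<open>finite (range (eval_ac x))\<close> finite_subset by blast
  then have "\<not> inj (\<lambda>n. (eval_ac x (u ^ n), eval_ac x (v ^ n)))"
    using finite_imageD infinite_UNIV_nat by blast
  then obtain i j where ij: "i \<noteq> j" "eval_ac x u ^ i = eval_ac x u ^ j" "eval_ac x v ^ i = eval_ac x v ^ j"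
    by (auto simp: inj_def hom_power)
  then have "var_ac ^ i = (var_ac ^ j :: 'a poly fract alg_closure)"
    using uv by (simp add: power_mult_distrib)
  then have "rf_var ^ i = (rf_var ^ j :: 'a poly fract)"
    by (metis to_ac_eq_iff to_ac_power)
  then have "monom (1 :: 'a) i = monom 1 j"
    by (simp add: rf_var_power)
  then have "coeff (monom (1 :: 'a) i) i = coeff (monom 1 j) i"
    by simp
  then show False
    using ij(1) by simp
qed

lemma ex_galois_transitive:
  assumes "x \<in> roots_ac (F_poly m a b)" "y \<in> roots_ac (F_poly m a b)"
  shows "\<exists>\<sigma>\<in>carrier (galois_group (F_poly m a b)). \<sigma> x = y"
proof -
  interpret x: hom_on UNIV "eval_ac x" by (rule hom_on_eval_ac)
  interpret y: hom_on UNIV "eval_ac y" by (rule hom_on_eval_ac)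
  have "eval_ac x r = 0 \<longleftrightarrow> eval_ac y r = 0" for r
    using root_transcendental assms x.hom_zero y.hom_zero by blast
  then obtain L \<phi> where "algebra_hom L \<phi>" and L: "\<And>r. eval_ac x r \<in> L" "\<And>r. \<phi> (eval_ac x r) = eval_ac y r"
    using algebra_hom_fractions[OF x.hom_on_axioms y.hom_on_axioms _ eval_ac_const eval_ac_const
        eval_ac_root(2,1)[OF assms(1)] eval_ac_root(1)[OF assms(2)]] by metis
  then interpret algebra_hom L \<phi> by simp
  have "x \<in> L" "\<phi> x = y"
    using L[of "[:0, 1:]"] by (simp_all add: eval_ac_var)
  then show ?thesis
    using extend_to_galois_group[OF F_poly_has_root(2)[OF m, of a b]] assms(1) roots_subset_splitting_field
    by (metis subsetD)
qed

text \<open>Up to the factor \<open>x - a\<close>, this is \<open>F / (X - x)\<close> as a polynomial in \<open>X\<close> over the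
  polynomials in \<open>x\<close>, after substituting \<open>t = (x ^ m - b) / (x - a)\<close>.\<close>

definition cofactor :: "'a poly poly" where
  "cofactor = (\<Sum>i<m. monom ([:-a, 1:] * [:0, 1:] ^ (m - 1 - i)) i) - [:[:0, 1:] ^ m - [:b:]:]"

lemma coeff_cofactor:
  "coeff cofactor i = (if i < m then [:-a, 1:] * [:0, 1:] ^ (m - 1 - i) else 0)
     - (if i = 0 then [:0, 1:] ^ m - [:b:] else 0)"
  unfolding cofactor_def coeff_diff coeff_sum coeff_monom
  by (simp add: coeff_pCons sum.delta' del: mult_pCons_left split: nat.split)

text \<open>Eisenstein conditions at the prime \<open>[:-a, 1:]\<close>: the constant coefficient
  takes the value b - a^m at \<open>a\<close>.\<close>

lemma poly_coeff_cofactor: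
  "poly (coeff cofactor 0) a \<noteq> 0" "i > 0 \<Longrightarrow> poly (coeff cofactor i) a = 0"
  using ab by (auto simp: coeff_cofactor)

lemma cofactor_irreducible:
  assumes "d \<noteq> 0" "smult d cofactor = U * V"
  shows "degree U = 0 \<or> degree V = 0"
proof (cases "m = 1")
  \<comment> \<open>Here \<open>cofactor\<close> is the constant b - a, whose leading coefficient is
    not divisible by \<open>[:-a, 1:]\<close>, so the degree is counted directly.\<close>
  case True
  have "cofactor \<noteq> 0"
    using poly_coeff_cofactor(1) by force
  then have "degree U + degree V = degree (smult d cofactor)"
    using assms by (metis degree_mult_eq mult_zero_left mult_zero_right smult_eq_0_iff)
  moreover have "coeff cofactor i = 0" if "i > 0" for i
    unfolding coeff_cofactor using that True by simp
  then have "degree (smult d cofactor) \<le> 0"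
    using degree_le[of 0 cofactor] by (simp add: \<open>d \<noteq> 0\<close>)
  ultimately show ?thesis by simp
next
  case False
  with m have "m - 1 > 0" by simp
  then have top: "coeff cofactor (m - 1) = [:-a, 1:]"
    by (simp add: coeff_cofactor)
  have "degree cofactor = m - 1"
    using top m by (intro order.antisym degree_le le_degree) (auto simp: coeff_cofactor)
  then have "lead_coeff cofactor = [:-a, 1:] * 1"
    using top by simp
  from reverse_Eisenstein[OF poly_coeff_cofactor this _ assms] show ?thesis
    by simp
qed

text \<open>Multiplying by y - x telescopes the sum to y^m - x^m, which equals t * (y - x) by
  subtracting the two root equations.\<close>

lemma eval2_ac_cofactor:
  assumes x: "x \<in> roots_ac (F_poly m a b)" and y: "y \<in> roots_ac (F_poly m a b)" and "x \<noteq> y"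
  shows "eval2_ac x y cofactor = 0"
proof -
  interpret x: hom_on UNIV "eval_ac x" by (rule hom_on_eval_ac)
  interpret hom_on UNIV "eval2_ac x y" by (rule hom_on_eval2_ac)
  obtain n where n: "m = Suc n" using m by (cases m) auto
  have "eval2_ac x y cofactor
      = (\<Sum>i<m. (x - const_ac a) * x ^ (m - 1 - i) * y ^ i) - var_ac * (x - const_ac a)"
    unfolding cofactor_def hom_diff[OF UNIV_I UNIV_I] hom_sum[OF UNIV_I] eval2_ac_monom
      x.hom_mult[OF UNIV_I UNIV_I] eval2_ac_const eval_ac_root(1)[OF x]
    by (simp add: x.hom_power eval_ac_var eval_ac_linear)
  also have "(\<Sum>i<m. (x - const_ac a) * x ^ (m - 1 - i) * y ^ i)
      = (x - const_ac a) * (\<Sum>i<Suc n. y ^ i * x ^ (n - i))"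
    by (simp add: n sum_distrib_left mult_ac del: sum.lessThan_Suc)
  finally have "(y - x) * eval2_ac x y cofactor
      = (x - const_ac a) * ((y - x) * (\<Sum>i<Suc n. y ^ i * x ^ (n - i)))
        - (y - x) * (var_ac * (x - const_ac a))"
    by (simp only: right_diff_distrib mult_ac)
  also have "\<dots> = (x - const_ac a) * (y ^ m - x ^ m) - (y - x) * (var_ac * (x - const_ac a))"
    by (simp only: diff_power_eq_sum n)
  also have "y ^ m - x ^ m = var_ac * (y - const_ac a) - var_ac * (x - const_ac a)"
    using x y unfolding mem_roots_F_poly_iff by (metis diff_diff_eq2 diff_add_cancel)
  also have "(x - const_ac a) * \<dots> - (y - x) * (var_ac * (x - const_ac a)) = 0"
    by (simp add: algebra_simps)
  finally show ?thesis
    using \<open>x \<noteq> y\<close> by simp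
qed

text \<open>Up to a nonzero scalar \<open>d\<close>, \<open>f\<close> is a multiple of
  \<open>cofactor\<close>, which also vanishes at \<open>z\<close>; the value of \<open>d\<close> at
  \<open>x\<close> is nonzero by transcendence and can be cancelled.\<close>

lemma eval2_ac_kernel:
  assumes x: "x \<in> roots_ac (F_poly m a b)"
    and "y \<in> roots_ac (F_poly m a b) - {x}" "z \<in> roots_ac (F_poly m a b) - {x}"
    and "eval2_ac x y f = 0"
  shows "eval2_ac x z f = 0"
proof -
  interpret z: hom_on UNIV "eval2_ac x z" by (rule hom_on_eval2_ac)
  have "\<exists>d k. d \<noteq> 0 \<and> smult d f = cofactor * k"
  proof (rule kernel_multiple_of_irreducible[OF hom_on_eval2_ac[of x y]])
    show "c = 0" if "eval2_ac x y [:c:] = 0" for c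
      using that root_transcendental[OF x] by simp
    show "degree U = 0 \<or> degree V = 0" if "d \<noteq> 0" "smult d cofactor = U * V" for d U V
      using that by (rule cofactor_irreducible)
    show "cofactor \<noteq> 0"
      using poly_coeff_cofactor(1) by force
    show "eval2_ac x y cofactor = 0"
      using assms by (intro eval2_ac_cofactor) auto
  qed fact
  then obtain d k where dk: "d \<noteq> 0" "smult d f = cofactor * k"
    by blast
  have "eval2_ac x z ([:d:] * f) = eval2_ac x z (cofactor * k)"
    using dk by simp
  moreover have "eval2_ac x z cofactor = 0"
    using assms by (intro eval2_ac_cofactor) auto
  ultimately have "eval_ac x d * eval2_ac x z f = 0"
    unfolding z.hom_mult[OF UNIV_I UNIV_I] by simp
  then show ?thesis
    using dk(1) root_transcendental[OF x] by auto
qed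

lemma ex_galois_stabilizer:
  assumes x: "x \<in> roots_ac (F_poly m a b)"
    and y: "y \<in> roots_ac (F_poly m a b) - {x}" and z: "z \<in> roots_ac (F_poly m a b) - {x}"
  shows "\<exists>\<sigma>\<in>carrier (galois_group (F_poly m a b)). \<sigma> x = x \<and> \<sigma> y = z"
proof -
  have ker: "eval2_ac x y r = 0 \<longleftrightarrow> eval2_ac x z r = 0" for r
    using eval2_ac_kernel[OF x y z] eval2_ac_kernel[OF x z y] by blast
  have const: "eval2_ac x w [:[:c:]:] = const_ac c" for w c
    by simp
  \<comment> \<open>Both are constant in the outer variable: t is expressed through \<open>x\<close>
    alone, whether the outer variable goes to \<open>y\<close> or to \<open>z\<close>.\<close>
  let ?u = "[:[:0, 1:] ^ m - [:b:]:]" and ?v = "[:[:-a, 1:]:]"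
  have var: "eval2_ac x w ?v \<noteq> 0" "eval2_ac x w ?u = var_ac * eval2_ac x w ?v" for w
    using eval_ac_root[OF x] by (simp_all only: eval2_ac_const) auto
  obtain L \<phi> where "algebra_hom L \<phi>" and L: "\<And>r. eval2_ac x y r \<in> L" "\<And>r. \<phi> (eval2_ac x y r) = eval2_ac x z r"
    by (rule algebra_hom_fractions[where k = "\<lambda>c. [:[:c:]:]" and u = ?u and v = ?v,
          OF hom_on_eval2_ac hom_on_eval2_ac ker const const var(1,2) var(2)]) (rule that)
  then interpret algebra_hom L \<phi> by simp
  \<comment> \<open>Both evaluations send the inner variable to \<open>x\<close>, so
    \<open>x\<close> is fixed; the outer variable \<open>monom 1 1\<close> goes to \<open>y\<close>
    and to \<open>z\<close>, so \<open>y\<close> is moved to \<open>z\<close>.\<close>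
  have "x \<in> L" "\<phi> x = x"
    using L[of "[:[:0, 1:]:]"] by (simp_all add: eval_ac_var)
  moreover have "eval2_ac x w (monom 1 1) = w" for w
    using hom_on.hom_one[OF hom_on_eval_ac, of x] by simp
  then have "y \<in> L" "\<phi> y = z"
    using L[of "monom 1 1"] by metis+
  moreover have "x \<in> splitting_field (F_poly m a b)" "y \<in> splitting_field (F_poly m a b)"
    using x y roots_subset_splitting_field by blast+
  ultimately show ?thesis
    using extend_to_galois_group[OF F_poly_has_root(2)[OF m, of a b]] by metis
qed

end

theorem theorem3p2:
  fixes p q k m :: nat and a b :: "'a::{field,finite}"
  assumes "prime p" and "k > 0" and "q = p ^ k" and "card (UNIV :: 'a set) = q"
    and "m > 0"
    and "b \<noteq> a ^ m"
  shows "primitive_action (galois_group (F_poly m a b)) (roots_ac (F_poly m a b))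
           (galois_action (F_poly m a b))"
proof (rule primitive_action_if_doubly_transitive)
  let ?F = "F_poly m a b"
  show "roots_ac ?F \<noteq> {}"
    using F_poly_has_root(1) \<open>m > 0\<close> .
  show "transitive_action (galois_group ?F) (roots_ac ?F) (galois_action ?F)"
    using group_action_galois_action[OF F_poly_has_root(2)[OF \<open>m > 0\<close>, of a b]]
      ex_galois_transitive[OF \<open>m > 0\<close> \<open>b \<noteq> a ^ m\<close>]
    by (simp add: transitive_action_def transitive_action_axioms_def galois_action_def)
  fix x y z
  assume "x \<in> roots_ac ?F" "y \<in> roots_ac ?F - {x}" "z \<in> roots_ac ?F - {x}"
  then show "\<exists>\<sigma>\<in>carrier (galois_group ?F). galois_action ?F \<sigma> x = x \<and> galois_action ?F \<sigma> y = z"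
    using ex_galois_stabilizer[OF \<open>m > 0\<close> \<open>b \<noteq> a ^ m\<close>, of x y z] by (simp add: galois_action_def)
qed

end
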